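(* Let $G$ be a 3-connected graph (possibly infinite), $G'$ a graph (possibly infinite), and $f$ a circuit injection from $G$ onto $G'$. Then $f$ is induced by a vertex isomorphism, i.e. there is a bijection $\lambda$ from the vertex set of $G$ onto the vertex set of $G'$ such that $f((u,v))=(\lambda(u),\lambda(v))$ for every edge $(u,v)$ of $G$.
   Context: Graphs are undirected, finite or infinite, without loops or multiple edges; a circuit is a (finite) cycle, regarded as its set of edges. A circuit injection from $G$ onto $G'$ is a one-to-one map $f$ from the edge set of $G$ onto the edge set of $G'$ such that $f(C)$ is a circuit of $G'$ whenever $C$ is a circuit of $G$; "onto $G'$" includes the requirement that $G'$ has no isolated vertices. *)

theory Defs
  imports Main
begin

text \<open>An undirected graph is a pair of a vertex set \<open>V\<close> and an edge set \<open>E\<close>; either may be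
  infinite. Edges are two-element sets of vertices, which rules out loops and multiple edges.\<close>

definition simple_graph :: "'a set \<Rightarrow> 'a set set \<Rightarrow> bool" where
  "simple_graph V E \<longleftrightarrow> (\<forall>e\<in>E. \<exists>u v. u \<in> V \<and> v \<in> V \<and> u \<noteq> v \<and> e = {u, v})"

definition connected_graph :: "'a set \<Rightarrow> 'a set set \<Rightarrow> bool" where
  "connected_graph V E \<longleftrightarrow>
     V \<noteq> {} \<and> (\<forall>u\<in>V. \<forall>v\<in>V. (u, v) \<in> {(x, y). {x, y} \<in> E}\<^sup>*)"

text \<open>More than \<open>k\<close> vertices, and deleting fewer than \<open>k\<close> vertices never disconnects. As
  \<^const>\<open>card\<close> is \<open>0\<close> on infinite sets, finiteness has to be made explicit.\<close>

definition k_connected :: "nat \<Rightarrow> 'a set \<Rightarrow> 'a set set \<Rightarrow> bool" where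
  "k_connected k V E \<longleftrightarrow>
     (infinite V \<or> k < card V) \<and>
     (\<forall>X. X \<subseteq> V \<and> finite X \<and> card X < k \<longrightarrow>
        connected_graph (V - X) {e \<in> E. e \<inter> X = {}})"

definition circuit :: "'a set set \<Rightarrow> 'a set set \<Rightarrow> bool" where
  "circuit E C \<longleftrightarrow> C \<subseteq> E \<and>
     (\<exists>vs. distinct vs \<and> 3 \<le> length vs \<and>
        C = {{vs ! i, vs ! (Suc i mod length vs)} | i. i < length vs})"

text \<open>The condition \<open>V' = \<Union>E'\<close> says, for a simple graph, that there are no isolated
  vertices. The vertex set of the domain graph plays no role.\<close>

definition circuit_injection_onto ::
  "'a set set \<Rightarrow> 'b set \<Rightarrow> 'b set set \<Rightarrow> ('a set \<Rightarrow> 'b set) \<Rightarrow> bool" where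
  "circuit_injection_onto E V' E' f \<longleftrightarrow>
     bij_betw f E E' \<and> (\<forall>C. circuit E C \<longrightarrow> circuit E' (f ` C)) \<and> V' = \<Union>E'"

end

theory Submission
  imports Defs
begin

text \<open>The preimage \<open>F\<close> of the star of a vertex \<open>v\<close> of \<open>G'\<close> meets every circuit of \<open>G\<close> in zero
  or two edges. In a 2-connected graph such a set is a bond, that is, the set of edges between two
  connected sides \<open>A\<close> and \<open>B\<close>, and in a 3-connected graph both sides are again free of cut
  vertices and two such bonds never cross. If both sides had two vertices, take a circuit \<open>C\<close>
  through an edge inside \<open>A\<close> and an edge inside \<open>B\<close>: the path \<open>f(C) - v\<close> contains consecutive
  edges coming from \<open>A\<close> and \<open>B\<close>, and the bond belonging to their common vertex would cross
  \<open>F\<close>. Hence one side is a single vertex, stars pull back to stars, and this gives the vertex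
  bijection.\<close>

section \<open>Paths and circuits\<close>

text \<open>The map \<open>f\<close> carries circuits in one direction only, so nothing is known
  about preimages of circuits or images of paths. What can be carried back is incidence with a fixed
  vertex of \<open>G'\<close>, because a circuit has zero or two edges there and \<open>f\<close> is
  injective. The zero-or-two condition does not by itself force a star: the three rungs of a prism,
  which is 3-connected, meet every circuit in zero or two edges. A single pulled-back star therefore
  cannot be settled in isolation, and a second one has to be played against it. The bond of the
  common vertex contains an edge inside \<open>A\<close> and an edge inside \<open>B\<close>, so
  each of \<open>A\<close> and \<open>B\<close> meets both of its sides; this is why the two bonds
  cross. Infinite graphs need no separate treatment, since every step uses either one finite circuit
  or a condition on cuts.\<close>

fun path_edges :: "'a list \<Rightarrow> 'a set set" where
  "path_edges (x # y # xs) = insert {x, y} (path_edges (y # xs))"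
| "path_edges _ = {}"

definition is_path :: "'a set set \<Rightarrow> 'a set \<Rightarrow> 'a list \<Rightarrow> bool" where
  "is_path E B xs \<longleftrightarrow> xs \<noteq> [] \<and> distinct xs \<and> set xs \<subseteq> B \<and> path_edges xs \<subseteq> E"

lemma path_edges_Cons:
  "xs \<noteq> [] \<Longrightarrow> path_edges (x # xs) = insert {x, hd xs} (path_edges xs)"
  by (cases xs) auto

lemma path_edges_append:
  assumes "xs \<noteq> []" "ys \<noteq> []"
  shows "path_edges (xs @ ys) = insert {last xs, hd ys} (path_edges xs \<union> path_edges ys)"
  using assms by (induction xs rule: path_edges.induct) (auto simp: path_edges_Cons)

lemma path_edges_rev: "path_edges (rev xs) = path_edges xs"
proof (induction xs)
  case (Cons x xs)
  then show ?case
    by (cases "xs = []") (auto simp: path_edges_append path_edges_Cons last_rev insert_commute)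
qed simp

lemma path_edges_nth: "path_edges xs = {{xs ! i, xs ! Suc i} | i. Suc i < length xs}"
proof (induction xs rule: path_edges.induct)
  case (1 x y xs)
  have "{{(x # y # xs) ! i, (x # y # xs) ! Suc i} | i. Suc i < length (x # y # xs)} =
     insert {x, y} {{(y # xs) ! i, (y # xs) ! Suc i} | i. Suc i < length (y # xs)}" (is "?l = ?r")
  proof
    show "?l \<subseteq> ?r"
    proof
      fix e assume "e \<in> ?l"
      then obtain i where i: "Suc i < length (x # y # xs)" "e = {(x # y # xs) ! i, (x # y # xs) ! Suc i}"
        by blast
      show "e \<in> ?r" using i by (cases i) auto
    qed
    show "?r \<subseteq> ?l"
    proof
      fix e assume "e \<in> ?r"
      then consider "e = {x, y}"
        | i where "Suc i < length (y # xs)" "e = {(y # xs) ! i, (y # xs) ! Suc i}" by blast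
      then show "e \<in> ?l"
      proof cases
        case 1 then show ?thesis by (auto intro!: exI[of _ 0])
      next
        case 2 then show ?thesis by (auto intro!: exI[of _ "Suc i"])
      qed
    qed
  qed
  with 1 show ?case by simp
qed auto

text \<open>The index \<open>length vs - 1\<close> wraps around to 0 and gives the closing edge; the
  other indices give the path. Circuits can thus be handled as paths plus one edge.\<close>

lemma cyclic_edges_conv:
  assumes "vs \<noteq> []"
  shows "{{vs ! i, vs ! (Suc i mod length vs)} | i. i < length vs}
    = insert {last vs, hd vs} (path_edges vs)" (is "?l = ?r")
proof
  have n: "0 < length vs" using assms by simp
  show "?l \<subseteq> ?r"
  proof
    fix e assume "e \<in> ?l"
    then obtain i where i: "i < length vs" "e = {vs ! i, vs ! (Suc i mod length vs)}" by blast
    show "e \<in> ?r"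
    proof (cases "Suc i = length vs")
      case True
      then have "i = length vs - 1" by simp
      with True i assms show ?thesis by (simp add: last_conv_nth hd_conv_nth)
    next
      case False
      with i show ?thesis by (auto simp: path_edges_nth)
    qed
  qed
  show "?r \<subseteq> ?l"
  proof
    fix e assume "e \<in> ?r"
    then consider "e = {last vs, hd vs}" | i where "Suc i < length vs" "e = {vs ! i, vs ! Suc i}"
      by (auto simp: path_edges_nth)
    then show "e \<in> ?l"
    proof cases
      case 1
      with n show ?thesis
        by (auto intro!: exI[of _ "length vs - 1"] simp: last_conv_nth hd_conv_nth)
    next
      case 2
      then show ?thesis by (auto intro!: exI[of _ i])
    qed
  qed
qed

lemma circuit_iff:
  "circuit E C \<longleftrightarrow> (\<exists>vs. is_path E UNIV vs \<and> 3 \<le> length vs \<and> {last vs, hd vs} \<in> E \<and>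
     C = insert {last vs, hd vs} (path_edges vs))"
proof -
  have *: "(distinct vs \<and> 3 \<le> length vs \<and>
       C = {{vs ! i, vs ! (Suc i mod length vs)} | i. i < length vs}) \<longleftrightarrow>
     (distinct vs \<and> 3 \<le> length vs \<and> C = insert {last vs, hd vs} (path_edges vs))" for vs
  proof (cases "vs = []")
    case False
    show ?thesis unfolding cyclic_edges_conv[OF False] ..
  next
    case True
    then have "\<not> 3 \<le> length vs" by simp
    then show ?thesis by blast
  qed
  have "circuit E C \<longleftrightarrow> C \<subseteq> E \<and>
      (\<exists>vs. distinct vs \<and> 3 \<le> length vs \<and> C = insert {last vs, hd vs} (path_edges vs))"
    unfolding circuit_def by (intro conj_cong[OF refl] ex_cong1 *)
  also have "\<dots> \<longleftrightarrow> (\<exists>vs. is_path E UNIV vs \<and> 3 \<le> length vs \<and> {last vs, hd vs} \<in> E \<and>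
     C = insert {last vs, hd vs} (path_edges vs))"
    unfolding ex_simps(2)[symmetric]
  proof (rule ex_cong1)
    fix vs :: "'a list"
    show "(C \<subseteq> E \<and> distinct vs \<and> 3 \<le> length vs \<and> C = insert {last vs, hd vs} (path_edges vs)) \<longleftrightarrow>
      is_path E UNIV vs \<and> 3 \<le> length vs \<and> {last vs, hd vs} \<in> E \<and>
      C = insert {last vs, hd vs} (path_edges vs)"
      by (cases "vs = []") (simp_all add: is_path_def, blast)
  qed
  finally show ?thesis .
qed

lemma is_path_mono: "is_path E B xs \<Longrightarrow> E \<subseteq> E' \<Longrightarrow> B \<subseteq> B' \<Longrightarrow> is_path E' B' xs"
  by (auto simp: is_path_def)

lemma is_path_append:
  assumes "is_path E B xs" "is_path E B ys" "set xs \<inter> set ys = {}" "{last xs, hd ys} \<in> E"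
  shows "is_path E B (xs @ ys)"
  using assms by (auto simp: is_path_def path_edges_append)

lemma is_path_rev: "is_path E B (rev xs) \<longleftrightarrow> is_path E B xs"
  by (simp add: is_path_def path_edges_rev)

lemma is_path_appendD:
  assumes "is_path E B (xs @ ys)"
  shows "xs \<noteq> [] \<Longrightarrow> is_path E B xs" "ys \<noteq> [] \<Longrightarrow> is_path E B ys"
    "xs \<noteq> [] \<Longrightarrow> ys \<noteq> [] \<Longrightarrow> {last xs, hd ys} \<in> E"
  using assms by (cases "xs = []"; cases "ys = []"; force simp: is_path_def path_edges_append)+

lemma is_path_singleton: "is_path E B [x] \<longleftrightarrow> x \<in> B"
  by (simp add: is_path_def)

lemma finite_path_edges: "finite (path_edges xs)"
  by (induction xs rule: path_edges.induct) auto

lemma finite_circuit: "circuit E C \<Longrightarrow> finite C"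
  by (auto simp: circuit_iff finite_path_edges)

lemma path_edges_subset: "e \<in> path_edges xs \<Longrightarrow> e \<subseteq> set xs"
  by (induction xs rule: path_edges.induct) auto

lemma path_crossing:
  assumes "xs \<noteq> []" "hd xs \<in> K" "last xs \<notin> K"
  obtains x y where "x \<in> K" "y \<notin> K" "x \<in> set xs" "y \<in> set xs" "{x, y} \<in> path_edges xs"
  using assms
proof (induction xs arbitrary: thesis rule: path_edges.induct)
  case (1 x y xs)
  show ?case
  proof (cases "y \<in> K")
    case True
    with 1 show ?thesis by (metis last_ConsR list.discI list.sel(1) list.set_intros(2) path_edges.simps(1) insertCI)
  next
    case False
    with 1 show ?thesis by simp
  qed
qed auto

text \<open>The length bound excludes two single vertices, whose two joining edges would
  coincide.\<close>

lemma circuit_of_paths: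
  assumes "is_path E B P" "is_path E B Q" "set P \<inter> set Q = {}"
    and "{last P, hd Q} \<in> E" "{last Q, hd P} \<in> E" "3 \<le> length P + length Q"
  shows "circuit E ({{last P, hd Q}, {last Q, hd P}} \<union> path_edges P \<union> path_edges Q)"
proof -
  have ne: "P \<noteq> []" "Q \<noteq> []" using assms by (auto simp: is_path_def)
  have "is_path E UNIV (P @ Q)"
    using is_path_mono[OF is_path_append[OF assms(1-4)]] by auto
  then show ?thesis
    unfolding circuit_iff
    by (intro exI[of _ "P @ Q"]) (use assms ne in \<open>auto simp: path_edges_append\<close>)
qed

lemma circuit_at_vertex:
  assumes "circuit E C" "v \<in> \<Union>C"
  obtains ys where "2 \<le> length ys" "distinct ys" "v \<notin> set ys"
    "C = {{v, hd ys}, {v, last ys}} \<union> path_edges ys"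
proof -
  obtain vs where vs: "is_path E UNIV vs" "3 \<le> length vs" "C = insert {last vs, hd vs} (path_edges vs)"
    using assms by (auto simp: circuit_iff)
  have ne: "vs \<noteq> []" using vs by auto
  have "v \<in> set vs" using assms(2) vs ne path_edges_subset by fastforce
  then obtain xs zs where x: "vs = xs @ v # zs" by (meson split_list)
  have ln: "2 \<le> length (zs @ xs)" using vs x by auto
  have d: "distinct (zs @ xs)" "v \<notin> set (zs @ xs)" using vs x by (auto simp: is_path_def)
  \<comment> \<open>Reading the cyclic list from \<open>v\<close> onwards gives
    \<open>v # zs @ xs\<close>.\<close>
  have "C = {{v, hd (zs @ xs)}, {v, last (zs @ xs)}} \<union> path_edges (zs @ xs)"
    using ln by (cases "xs = []"; cases "zs = []")
      (auto simp: vs(3) x path_edges_append path_edges_Cons insert_commute)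
  with that ln d show thesis by blast
qed

lemma circuit_degree:
  assumes "circuit E C"
  shows "card {e \<in> C. v \<in> e} = 0 \<or> card {e \<in> C. v \<in> e} = 2"
proof (cases "v \<in> \<Union>C")
  case True
  then obtain ys where ys: "2 \<le> length ys" "distinct ys" "v \<notin> set ys"
    "C = {{v, hd ys}, {v, last ys}} \<union> path_edges ys"
    using circuit_at_vertex[OF assms] by blast
  have "{e \<in> C. v \<in> e} = {{v, hd ys}, {v, last ys}}"
    using ys path_edges_subset by fastforce
  moreover have "hd ys \<noteq> last ys"
    using ys(1,2) by (cases ys) (auto split: if_splits)
  then have "{v, hd ys} \<noteq> {v, last ys}" by (auto simp: doubleton_eq_iff)
  ultimately show ?thesis by simp
next
  case False
  then have "{e \<in> C. v \<in> e} = {}" by auto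
  then show ?thesis by (metis card.empty)
qed

text \<open>Somewhere along the path the class of the edges changes. \<open>K\<close> and
  \<open>K'\<close> may overlap; an edge in both serves as \<open>e\<close> and as
  \<open>e'\<close>.\<close>

lemma path_colour_change:
  assumes "path_edges xs \<subseteq> K \<union> K'" "path_edges xs \<inter> K \<noteq> {}" "path_edges xs \<inter> K' \<noteq> {}"
  shows "\<exists>w\<in>set xs. \<exists>e\<in>path_edges xs \<inter> K. \<exists>e'\<in>path_edges xs \<inter> K'. w \<in> e \<and> w \<in> e'"
  using assms
proof (induction xs rule: path_edges.induct)
  case (1 x y xs)
  let ?P = "path_edges (y # xs)"
  show ?case
  proof (cases "?P \<inter> K \<noteq> {} \<and> ?P \<inter> K' \<noteq> {}")
    case True
    moreover have "?P \<subseteq> K \<union> K'" using 1 by auto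
    ultimately obtain w e e' where "w \<in> set (y # xs)" "e \<in> ?P \<inter> K" "e' \<in> ?P \<inter> K'" "w \<in> e" "w \<in> e'"
      using "1.IH" by blast
    moreover have "?P \<subseteq> path_edges (x # y # xs)" "set (y # xs) \<subseteq> set (x # y # xs)" by auto
    ultimately show ?thesis by (meson Int_iff subsetD)
  next
    case False
    have y: "y \<in> set (x # y # xs)" by simp
    show ?thesis
    proof (cases xs)
      case Nil
      then have "{x, y} \<in> K \<inter> K'" using "1.prems" by auto
      then show ?thesis using y by (metis IntD1 IntD2 IntI insertCI path_edges.simps(1))
    next
      case (Cons z zs)
      then have "{y, z} \<in> ?P" by simp
      moreover have "{x, y} \<in> K \<and> {y, z} \<in> K' \<or> {x, y} \<in> K' \<and> {y, z} \<in> K"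
        using False "1.prems" \<open>{y, z} \<in> ?P\<close> by auto
      ultimately have "\<exists>e\<in>path_edges (x # y # xs) \<inter> K. \<exists>e'\<in>path_edges (x # y # xs) \<inter> K'. y \<in> e \<and> y \<in> e'"
        by (metis IntI insertCI insertI1 path_edges.simps(1))
      then show ?thesis using y by blast
    qed
  qed
qed auto

section \<open>Connected vertex sets and Menger's theorem for two paths\<close>

text \<open>Stated through cuts, connectivity holds for empty and one-vertex sets, so deleting
  vertices creates no nonemptiness conditions.\<close>

definition conn :: "'a set set \<Rightarrow> 'a set \<Rightarrow> bool" where
  "conn E B \<longleftrightarrow> (\<forall>L\<subseteq>B. L \<noteq> {} \<and> L \<noteq> B \<longrightarrow> (\<exists>x\<in>L. \<exists>y\<in>B - L. {x, y} \<in> E))"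

text \<open>Single vertices and single edges count as biconnected, since the side of a bond may be
  that small.\<close>

definition biconn :: "'a set set \<Rightarrow> 'a set \<Rightarrow> bool" where
  "biconn E B \<longleftrightarrow> conn E B \<and> (\<forall>t. conn E (B - {t}))"

definition component :: "'a set set \<Rightarrow> 'a set \<Rightarrow> 'a \<Rightarrow> 'a set" where
  "component E B a = {x. \<exists>xs. is_path E B xs \<and> hd xs = a \<and> last xs = x}"

lemma connD:
  assumes "conn E B" "L \<subseteq> B" "x \<in> L" "y \<in> B - L"
  obtains u v where "u \<in> L" "v \<in> B - L" "{u, v} \<in> E"
proof -
  have "L \<noteq> {}" "L \<noteq> B" using assms by auto
  with assms that show thesis unfolding conn_def by meson
qed

lemma conn_mono: "conn E B \<Longrightarrow> E \<subseteq> E' \<Longrightarrow> conn E' B"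
  unfolding conn_def by (meson subsetD)

lemma component_subset: "component E B a \<subseteq> B"
  by (auto simp: component_def is_path_def)

lemma component_self: "a \<in> B \<Longrightarrow> a \<in> component E B a"
  by (auto simp: component_def intro!: exI[of _ "[a]"] simp: is_path_singleton)

lemma path_subset_component:
  assumes "is_path E B xs"
  shows "set xs \<subseteq> component E B (hd xs)"
proof
  fix y assume "y \<in> set xs"
  then obtain us vs where x: "xs = (us @ [y]) @ vs" by (metis append_assoc append_Cons append_Nil split_list)
  then have "is_path E B (us @ [y])" using is_path_appendD(1) assms by blast
  moreover have "hd (us @ [y]) = hd xs" by (simp add: x hd_append)
  ultimately show "y \<in> component E B (hd xs)" unfolding component_def by fastforce
qed

lemma component_closed:
  assumes "x \<in> component E B a" "y \<in> B" "{x, y} \<in> E"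
  shows "y \<in> component E B a"
proof -
  obtain xs where xs: "is_path E B xs" "hd xs = a" "last xs = x" using assms by (auto simp: component_def)
  show ?thesis
  proof (cases "y \<in> set xs")
    case True
    then show ?thesis using path_subset_component[OF xs(1)] xs by auto
  next
    case False
    then have "is_path E B (xs @ [y])" using xs assms by (intro is_path_append) (auto simp: is_path_singleton)
    moreover have "hd (xs @ [y]) = a" using xs by (auto simp: is_path_def)
    ultimately show ?thesis unfolding component_def by fastforce
  qed
qed

lemma conn_component: "conn E (component E B a)"
  unfolding conn_def
proof (intro allI impI)
  fix L assume L: "L \<subseteq> component E B a" "L \<noteq> {} \<and> L \<noteq> component E B a"
  have *: "\<exists>x\<in>K. \<exists>y\<in>component E B a - K. {x, y} \<in> E" if z: "a \<in> K" "z \<in> component E B a - K" for K z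
  proof -
    obtain xs where xs: "is_path E B xs" "hd xs = a" "last xs = z" using z by (auto simp: component_def)
    then have "xs \<noteq> []" by (simp add: is_path_def)
    then obtain x y where "x \<in> K" "y \<notin> K" "x \<in> set xs" "y \<in> set xs" "{x, y} \<in> path_edges xs"
      by (rule path_crossing[of xs K]) (use xs z in auto)
    then have "x \<in> K" "y \<in> component E B a - K" "{x, y} \<in> E"
      using path_subset_component[OF xs(1)] xs(1,2) by (auto simp: is_path_def)
    then show ?thesis by blast
  qed
  show "\<exists>x\<in>L. \<exists>y\<in>component E B a - L. {x, y} \<in> E"
  proof (cases "a \<in> L")
    case True
    then show ?thesis using *[of L] L by auto
  next
    case False
    obtain z where "z \<in> L" using L by auto
    have "a \<in> component E B a"
    proof -
      obtain xs where "is_path E B xs" "hd xs = a" using \<open>z \<in> L\<close> L(1) by (auto simp: component_def)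
      then show ?thesis using path_subset_component[of E B xs] by (auto simp: is_path_def)
    qed
    then obtain x y where "x \<in> component E B a - L" "y \<in> component E B a - (component E B a - L)" "{x, y} \<in> E"
      using *[of "component E B a - L" z] False \<open>z \<in> L\<close> L(1) by blast
    then have "y \<in> L" "x \<in> component E B a - L" "{y, x} \<in> E" by (auto simp: insert_commute)
    then show ?thesis by blast
  qed
qed

lemma conn_path:
  assumes "conn E B" "a \<in> B" "b \<in> B"
  obtains xs where "is_path E B xs" "hd xs = a" "last xs = b"
proof -
  have "b \<in> component E B a"
  proof (rule ccontr)
    assume "b \<notin> component E B a"
    then obtain u v where "u \<in> component E B a" "v \<in> B - component E B a" "{u, v} \<in> E"
      using connD[OF assms(1) component_subset component_self] assms by (metis DiffI)
    then show False using component_closed by fastforce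
  qed
  then show thesis using that by (auto simp: component_def)
qed

lemma split_list_last_in:
  assumes "\<exists>x\<in>set xs. x \<in> K"
  obtains us z vs where "xs = us @ z # vs" "z \<in> K" "set vs \<inter> K = {}"
  using split_list_last_prop[OF assms] by (metis disjoint_iff)

text \<open>The induction runs along one finite path \<open>P\<close> and not over the size of the
  graph, so \<open>B\<close> may be infinite.\<close>

lemma two_disjoint_paths:
  assumes avoid: "\<And>t. \<exists>Q. is_path E (B - {t}) Q \<and> hd Q \<in> S \<and> last Q \<in> T"
  obtains R R' where "is_path E B R" "is_path E B R'" "hd R \<in> S" "hd R' \<in> S"
    "last R \<in> T" "last R' \<in> T" "set R \<inter> set R' = {}"
proof -
  obtain P where P: "is_path E B P" "hd P \<in> S" "last P \<in> T"
    using avoid is_path_mono[of E _ _ E B] by (metis Diff_subset order_refl)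
  then have Pne: "P \<noteq> []" by (simp add: is_path_def)
  \<comment> \<open>One of the two paths is dragged along \<open>P\<close>. When the next vertex \<open>p\<close> of \<open>P\<close> lies on the
    other path, the latter is given up beyond \<open>p\<close> and rerouted to \<open>T\<close> along a path avoiding \<open>p\<close>.\<close>
  define good where "good p R R' \<longleftrightarrow> is_path E B R \<and> is_path E B R' \<and> hd R \<in> S \<and> hd R' \<in> S \<and>
    last R = p \<and> last R' \<in> T \<and> set R \<inter> set R' = {}" for p R R'
  have "\<exists>R R'. good (P ! k) R R'" if "k < length P" for k
    using that
  proof (induction k)
    case 0
    obtain Q where "is_path E (B - {P ! 0}) Q" "hd Q \<in> S" "last Q \<in> T" using avoid by blast
    then have "good (P ! 0) [P ! 0] Q"
      using P Pne by (auto simp: good_def is_path_def hd_conv_nth)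
    then show ?case by blast
  next
    case (Suc k)
    define p where "p = P ! Suc k"
    obtain R R' where "good (P ! k) R R'" using Suc by auto
    then have R: "is_path E B R" "is_path E B R'" "hd R \<in> S" "hd R' \<in> S" "last R = P ! k"
      "last R' \<in> T" "set R \<inter> set R' = {}" by (auto simp: good_def)
    have ne: "R \<noteq> []" "R' \<noteq> []" using R by (auto simp: is_path_def)
    have pB: "p \<in> B" using Suc.prems P(1) nth_mem[of "Suc k" P] by (auto simp: is_path_def p_def)
    have "{P ! k, P ! Suc k} \<in> path_edges P" using Suc.prems by (auto simp: path_edges_nth)
    then have pE: "{last R, p} \<in> E" using P(1) R(5) by (auto simp: is_path_def p_def)
    consider "p \<in> set R" | "p \<notin> set R" "p \<notin> set R'" | "p \<notin> set R" "p \<in> set R'" by blast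
    then have "\<exists>R R'. good p R R'"
    proof cases
      case 1
      then obtain us vs where x: "R = (us @ [p]) @ vs"
        by (metis append_assoc append_Cons append_Nil split_list)
      have "is_path E B (us @ [p])" using is_path_appendD(1) R(1) x by blast
      moreover have "hd (us @ [p]) = hd R" using x by (simp add: hd_append)
      moreover have "set (us @ [p]) \<inter> set R' = {}" using R(7) x by auto
      ultimately have "good p (us @ [p]) R'" using R by (simp add: good_def)
      then show ?thesis by blast
    next
      case 2
      then have "is_path E B (R @ [p])" using pE R pB by (intro is_path_append) (auto simp: is_path_singleton)
      then have "good p (R @ [p]) R'" using R 2 ne by (simp add: good_def)
      then show ?thesis by blast
    next
      case 3
      then obtain us vs where x: "R' = us @ p # vs" by (meson split_list)
      have dj: "set R \<inter> set us = {}" "p \<notin> set us" using R(2,7) x by (auto simp: is_path_def)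
      have "is_path E B ((us @ [p]) @ vs)" using R(2) x by simp
      then have up: "is_path E B (us @ [p])" using is_path_appendD(1) by blast
      have hup: "hd (us @ [p]) \<in> S" using R(4) x by (simp add: hd_append split: if_splits)
      have Rp: "is_path E B (R @ [p])" using pE R(1) pB 3 by (intro is_path_append) (auto simp: is_path_singleton)
      have hRp: "hd (R @ [p]) \<in> S" using R(3) ne by simp
      obtain Q where Q: "is_path E (B - {p}) Q" "hd Q \<in> S" "last Q \<in> T" using avoid by blast
      then have QB: "is_path E B Q" "p \<notin> set Q" by (auto simp: is_path_def)
      show ?thesis
      proof (cases "\<exists>z\<in>set Q. z \<in> set R \<union> set us")
        case False
        then have "good p (R @ [p]) Q" using Rp hRp Q(2,3) QB by (auto simp: good_def)
        then show ?thesis by blast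
      next
        case True
        \<comment> \<open>\<open>z\<close> is the last vertex of \<open>Q\<close> on the pieces
          \<open>R\<close> and \<open>us\<close>. Beyond \<open>z\<close> the path \<open>Q\<close>
          meets neither, so the piece containing \<open>z\<close> can be continued along
          \<open>Q\<close> into \<open>T\<close>.\<close>
        then obtain q z q' where q: "Q = q @ z # q'" "z \<in> set R \<union> set us" "set q' \<inter> (set R \<union> set us) = {}"
          by (rule split_list_last_in)
        have pq: "p \<notin> set q'" using QB q by auto
        have reroute: "\<exists>N. is_path E B N \<and> hd N = hd M \<and> last N = last Q \<and> set N \<subseteq> set M \<union> set q'"
          if M: "is_path E B M" "z \<in> set M" "set q' \<inter> set M = {}" for M
        proof -
          obtain m m' where m: "M = (m @ [z]) @ m'"
            using M(2) by (metis append_assoc append_Cons append_Nil split_list)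
          then have mp: "is_path E B (m @ [z])" using is_path_appendD(1) M(1) by blast
          have hm: "hd (m @ [z]) = hd M" using m by (simp add: hd_append)
          show ?thesis
          proof (cases "q' = []")
            case True
            then show ?thesis using mp hm q(1) m by (intro exI[of _ "m @ [z]"]) auto
          next
            case False
            have "is_path E B ((q @ [z]) @ q')" using QB q by simp
            then have q': "is_path E B q'" "{z, hd q'} \<in> E"
              using is_path_appendD(2,3)[of E B "q @ [z]" q'] False by auto
            have "is_path E B ((m @ [z]) @ q')"
              by (rule is_path_append[OF mp q'(1)]) (use M(3) m q' in auto)
            moreover have "hd ((m @ [z]) @ q') = hd M" using hm by (auto simp: hd_append split: if_splits)
            moreover have "last ((m @ [z]) @ q') = last Q" using q(1) False by simp
            ultimately show ?thesis using m by (intro exI[of _ "(m @ [z]) @ q'"]) auto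
          qed
        qed
        show ?thesis
        proof (cases "z \<in> set R")
          case True
          \<comment> \<open>The roles swap here: the path that started as \<open>R\<close> now ends
            in \<open>T\<close>, and \<open>us @ [p]\<close> becomes the one dragged along
            \<open>P\<close>.\<close>
          then obtain N where N: "is_path E B N" "hd N = hd R" "last N = last Q" "set N \<subseteq> set R \<union> set q'"
            using reroute[of R] R(1) q(3) by blast
          then have "set (us @ [p]) \<inter> set N = {}" using dj pq q(3) 3(1) by auto
          then have "good p (us @ [p]) N" using up hup N R(3) Q(3) by (simp add: good_def)
          then show ?thesis by blast
        next
          case False
          then have zu: "z \<in> set us" using q by auto
          then have une: "us \<noteq> []" by auto
          have us: "is_path E B us" using is_path_appendD(1)[OF up une] .
          have hus: "hd us \<in> S" using hup une by simp
          obtain N where N: "is_path E B N" "hd N = hd us" "last N = last Q" "set N \<subseteq> set us \<union> set q'"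
            using reroute[of us] us q(3) zu by blast
          then have "set (R @ [p]) \<inter> set N = {}" using dj pq q(3) 3(1) by auto
          then have "good p (R @ [p]) N" using Rp hRp N hus Q(3) by (simp add: good_def)
          then show ?thesis by blast
        qed
      qed
    qed
    then show ?case by (simp add: p_def)
  qed
  \<comment> \<open>At the last vertex of \<open>P\<close>, which lies in \<open>T\<close>, both
    paths end in \<open>T\<close>.\<close>
  from this[of "length P - 1"] Pne obtain R R' where "good (last P) R R'"
    by (auto simp: last_conv_nth)
  then show thesis using that[of R R'] P(3) by (simp add: good_def)
qed

text \<open>If some \<open>t\<close> meets all paths from \<open>S\<close> to \<open>T\<close>, then
  \<open>L\<close> can be taken as everything reachable from \<open>S\<close> without
  \<open>t\<close>. This \<open>t\<close> may lie outside \<open>B\<close>.\<close>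

lemma two_paths_or_separator:
  assumes "S \<subseteq> B" "T \<subseteq> B"
  obtains (paths) R R' where "is_path E B R" "is_path E B R'" "hd R \<in> S" "hd R' \<in> S"
    "last R \<in> T" "last R' \<in> T" "set R \<inter> set R' = {}"
  | (sep) t L where "L \<subseteq> B - {t}" "S - {t} \<subseteq> L" "L \<inter> T = {}"
    "\<And>x y. x \<in> L \<Longrightarrow> y \<in> B - {t} - L \<Longrightarrow> {x, y} \<notin> E"
proof (cases "\<forall>t. \<exists>Q. is_path E (B - {t}) Q \<and> hd Q \<in> S \<and> last Q \<in> T")
  case True
  then show thesis using paths two_disjoint_paths[of E B S T] by metis
next
  case False
  then obtain t where t: "\<And>Q. is_path E (B - {t}) Q \<Longrightarrow> hd Q \<in> S \<Longrightarrow> last Q \<notin> T" by blast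
  define L where "L = (\<Union>s\<in>S. component E (B - {t}) s)"
  show thesis
  proof (rule sep[of L t])
    show "L \<subseteq> B - {t}" unfolding L_def using component_subset by fast
    show "S - {t} \<subseteq> L" unfolding L_def using assms component_self[of _ "B - {t}" E] by blast
    show "L \<inter> T = {}" unfolding L_def component_def using t by blast
    show "{x, y} \<notin> E" if "x \<in> L" "y \<in> B - {t} - L" for x y
      using that component_closed[of x E "B - {t}" _ y] unfolding L_def by blast
  qed
qed

text \<open>Deleting one vertex leaves one of \<open>a\<close>, \<open>b\<close> and one of
  \<open>c\<close>, \<open>d\<close>, and these remain connected, so the separator alternative
  fails.\<close>

lemma biconn_linked:
  assumes "biconn E B" "a \<in> B" "b \<in> B" "c \<in> B" "d \<in> B" "a \<noteq> b" "c \<noteq> d"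
  obtains P Q where "is_path E B P" "is_path E B Q" "set P \<inter> set Q = {}"
    "hd P = a" "hd Q = b" "{last P, last Q} = {c, d}"
proof -
  have "{a, b} \<subseteq> B" "{c, d} \<subseteq> B" using assms by auto
  then show thesis
  proof (cases rule: two_paths_or_separator[of "{a, b}" B "{c, d}" E])
    case (paths R R')
    then have ne: "R \<noteq> []" "R' \<noteq> []" by (auto simp: is_path_def)
    then have "hd R \<noteq> hd R'" "last R \<noteq> last R'"
      using paths(7) by (metis disjoint_iff list.set_sel(1), metis disjoint_iff last_in_set)
    then show thesis using that[of R R'] that[of R' R] paths by auto
  next
    case (sep t L)
    have "conn E (B - {t})" using assms by (simp add: biconn_def)
    moreover obtain x y where "x \<in> {a, b} - {t}" "y \<in> {c, d} - {t}" using assms by blast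
    then have "x \<in> L" "y \<in> (B - {t}) - L" using sep assms by auto
    ultimately show thesis using sep connD[of E "B - {t}" L x y] by metis
  qed
qed

section \<open>Edge sets meeting every circuit in zero or two edges\<close>

text \<open>Circuits are finite, so cardinality 0 really means an empty intersection.\<close>

definition tight :: "'a set set \<Rightarrow> 'a set set \<Rightarrow> bool" where
  "tight E F \<longleftrightarrow> F \<subseteq> E \<and> (\<forall>C. circuit E C \<longrightarrow> card (C \<inter> F) = 0 \<or> card (C \<inter> F) = 2)"

text \<open>As \<open>L\<close> and \<open>M\<close> partition \<open>B\<close>, the equivalence
  \<open>x \<in> L \<longleftrightarrow> y \<in> M\<close> says that \<open>x\<close> and
  \<open>y\<close> lie on different sides. The parameter \<open>B\<close> makes it possible to study
  one bond inside a single side of another.\<close>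

definition bond :: "'a set set \<Rightarrow> 'a set \<Rightarrow> 'a set set \<Rightarrow> 'a set \<Rightarrow> 'a set \<Rightarrow> bool" where
  "bond E B F L M \<longleftrightarrow> L \<union> M = B \<and> L \<inter> M = {} \<and> conn (E - F) L \<and> conn (E - F) M \<and>
     (\<forall>x\<in>B. \<forall>y\<in>B. {x, y} \<in> E \<longrightarrow> ({x, y} \<in> F \<longleftrightarrow> (x \<in> L \<longleftrightarrow> y \<in> M)))"

lemma bond_sym: "bond E B F L M \<Longrightarrow> bond E B F M L"
  unfolding bond_def by blast

lemma bond_conn: "bond E B F L M \<Longrightarrow> conn E L"
  unfolding bond_def using conn_mono by blast

lemma bond_crossing: "bond E B F L M \<Longrightarrow> x \<in> L \<Longrightarrow> y \<in> M \<Longrightarrow> {x, y} \<in> E \<Longrightarrow> {x, y} \<in> F"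
  unfolding bond_def by blast

lemma bond_inside: "bond E B F L M \<Longrightarrow> x \<in> L \<Longrightarrow> y \<in> L \<Longrightarrow> {x, y} \<in> E \<Longrightarrow> {x, y} \<notin> F"
  unfolding bond_def by blast

lemma tight_card: "tight E F \<Longrightarrow> circuit E C \<Longrightarrow> card (C \<inter> F) = 0 \<or> card (C \<inter> F) = 2"
  by (simp add: tight_def)

lemma tight_two:
  assumes "tight E F" "circuit E C" "e \<in> C \<inter> F" "e' \<in> C \<inter> F" "e \<noteq> e'"
  shows "C \<inter> F = {e, e'}"
proof -
  have fin: "finite (C \<inter> F)" using finite_circuit[OF assms(2)] by simp
  have sub: "{e, e'} \<subseteq> C \<inter> F" using assms(3,4) by blast
  have c: "card {e, e'} = 2" using assms(5) by simp
  have "card (C \<inter> F) = 2"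
    using tight_card[OF assms(1,2)] card_mono[OF fin sub] c by linarith
  then show ?thesis using card_subset_eq[OF fin sub] c by simp
qed

lemma tight_not_one:
  assumes "tight E F" "circuit E C"
  shows "C \<inter> F \<noteq> {e}"
proof
  assume "C \<inter> F = {e}"
  then show False using tight_card[OF assms] by simp
qed

lemma loop_free: "simple_graph V E \<Longrightarrow> {x, y} \<in> E \<Longrightarrow> x \<noteq> y"
  unfolding simple_graph_def by fastforce

lemma circuit_through_two_edges:
  assumes smp: "simple_graph V E" and bi: "biconn E B"
    and ab: "a \<in> B" "b \<in> B" "{a, b} \<in> E" and cd: "c \<in> B" "d \<in> B" "{c, d} \<in> E"
    and ne': "{a, b} \<noteq> {c, d}"
  obtains P Q where "is_path E B P" "is_path E B Q" "set P \<inter> set Q = {}"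
    "hd P = a" "hd Q = b" "{last P, last Q} = {c, d}"
    "circuit E ({{a, b}, {c, d}} \<union> path_edges P \<union> path_edges Q)"
proof -
  have "a \<noteq> b" "c \<noteq> d" using loop_free[OF smp] ab cd by blast+
  then obtain P Q where PQ: "is_path E B P" "is_path E B Q" "set P \<inter> set Q = {}"
    "hd P = a" "hd Q = b" "{last P, last Q} = {c, d}"
    using biconn_linked[OF bi ab(1,2) cd(1,2)] by metis
  have ne: "P \<noteq> []" "Q \<noteq> []" using PQ by (auto simp: is_path_def)
  \<comment> \<open>If both paths were single vertices, the two given edges would be equal.\<close>
  have len: "3 \<le> length P + length (rev Q)"
  proof (rule ccontr)
    assume "\<not> ?thesis"
    then have "length P = 1" "length Q = 1"
      using ne by (auto simp: not_le less_Suc_eq numeral_3_eq_3 neq_Nil_conv)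
    then have "P = [a]" "Q = [b]" using PQ by (auto simp: length_Suc_conv)
    then show False using PQ ne' by simp
  qed
  have "circuit E ({{last P, hd (rev Q)}, {last (rev Q), hd P}} \<union> path_edges P \<union> path_edges (rev Q))"
    by (rule circuit_of_paths[of E B])
      (use PQ ne len cd ab in \<open>auto simp: is_path_rev hd_rev last_rev insert_commute\<close>)
  moreover have "{{last P, hd (rev Q)}, {last (rev Q), hd P}} = {{a, b}, {c, d}}"
    using PQ(4-6) by (auto simp: hd_rev last_rev insert_commute)
  ultimately show thesis using that[OF PQ] by (simp add: path_edges_rev)
qed

text \<open>The sides are the components of \<open>a\<close> and \<open>b\<close> after deleting
  \<open>F\<close>. They differ, as a path avoiding \<open>F\<close> would close with
  \<open>{a, b}\<close> to a circuit with one edge in \<open>F\<close>. Any other edge of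
  \<open>F\<close> inside \<open>B\<close> lies with \<open>{a, b}\<close> on a circuit whose two
  linking paths avoid \<open>F\<close>, so it joins the same two components. A third component is
  impossible, since an edge leading out of the first two would belong to \<open>F\<close>.\<close>

lemma bond_of_tight:
  assumes smp: "simple_graph V E" and bi: "biconn E B" and tight: "tight E F"
    and ab: "a \<in> B" "b \<in> B" "{a, b} \<in> F"
  obtains L M where "bond E B F L M" "a \<in> L" "b \<in> M"
proof -
  have FE: "F \<subseteq> E" using tight by (simp add: tight_def)
  have nab: "a \<noteq> b" using loop_free[OF smp] ab FE by blast
  define L where "L = component (E - F) B a"
  define M where "M = component (E - F) B b"
  have LB: "L \<subseteq> B" "M \<subseteq> B" by (simp_all add: L_def M_def component_subset)
  have aL: "a \<in> L" and bM: "b \<in> M" using ab by (simp_all add: L_def M_def component_self)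
  have cL: "conn (E - F) L" and cM: "conn (E - F) M" by (simp_all add: L_def M_def conn_component)
  have clL: "y \<in> L" if "x \<in> L" "y \<in> B" "{x, y} \<in> E - F" for x y
    using component_closed[of x "E - F" B a y] that by (simp add: L_def)
  have clM: "y \<in> M" if "x \<in> M" "y \<in> B" "{x, y} \<in> E - F" for x y
    using component_closed[of x "E - F" B b y] that by (simp add: M_def)
  have bL: "b \<notin> L"
  proof
    assume "b \<in> L"
    then obtain xs where xs: "is_path (E - F) B xs" "hd xs = a" "last xs = b"
      by (auto simp: L_def component_def)
    obtain y ys where y: "xs = a # y # ys"
      using xs nab by (cases xs rule: path_edges.cases) (auto simp: is_path_def)
    have "{a, y} \<notin> F" using xs y by (auto simp: is_path_def)
    then have "ys \<noteq> []" using xs y ab by auto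
    have "circuit E (insert {last xs, hd xs} (path_edges xs))"
      unfolding circuit_iff using xs y ab FE \<open>ys \<noteq> []\<close>
      by (intro exI[of _ xs]) (auto simp: is_path_def insert_commute Suc_le_eq)
    moreover have "insert {last xs, hd xs} (path_edges xs) \<inter> F = {{a, b}}"
      using xs ab by (auto simp: is_path_def insert_commute)
    ultimately show False using tight_not_one[OF tight] by blast
  qed
  have dj: "L \<inter> M = {}"
  proof (rule ccontr)
    assume "L \<inter> M \<noteq> {}"
    then obtain z where "z \<in> L \<inter> M" by blast
    then obtain u v where "u \<in> L \<inter> M" "v \<in> M - L \<inter> M" "{u, v} \<in> E - F"
      using connD[OF cM, of "L \<inter> M" z b] bM bL by auto
    then show False using clL[of u v] LB by auto
  qed
  have crossF: "c \<in> L \<and> d \<in> M \<or> c \<in> M \<and> d \<in> L" if cd: "c \<in> B" "d \<in> B" "{c, d} \<in> F" for c d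
  proof (cases "{c, d} = {a, b}")
    case True
    then show ?thesis using aL bM by (auto simp: doubleton_eq_iff)
  next
    case False
    define C where "C P Q = {{a, b}, {c, d}} \<union> path_edges P \<union> path_edges Q" for P Q
    obtain P Q where PQ: "is_path E B P" "is_path E B Q" "set P \<inter> set Q = {}"
      "hd P = a" "hd Q = b" "{last P, last Q} = {c, d}" and C: "circuit E (C P Q)"
      using circuit_through_two_edges[OF smp bi ab(1,2) _ cd(1,2)] ab(3) cd(3) FE False
      unfolding C_def by (metis subsetD)
    have ne: "P \<noteq> []" "Q \<noteq> []" using PQ by (auto simp: is_path_def)
    have CF: "C P Q \<inter> F = {{a, b}, {c, d}}"
      by (rule tight_two[OF tight C]) (use ab cd False in \<open>auto simp: C_def\<close>)
    have sub: "path_edges P \<subseteq> C P Q" "path_edges Q \<subseteq> C P Q" by (auto simp: C_def)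
    have inP: "hd P \<in> set P" "last P \<in> set P" and inQ: "hd Q \<in> set Q" "last Q \<in> set Q"
      using ne by simp_all
    have "e \<notin> F" if e: "e \<in> path_edges P \<union> path_edges Q" for e
    proof
      assume "e \<in> F"
      \<comment> \<open>Each of these two edges has one end on \<open>P\<close> and one on
        \<open>Q\<close>, whereas \<open>e\<close> lies inside one of the disjoint paths.\<close>
      then have "e = {hd P, hd Q} \<or> e = {last P, last Q}" using CF sub e PQ(4-6) by auto
      moreover have "e \<subseteq> set P \<or> e \<subseteq> set Q" using e path_edges_subset by blast
      ultimately show False using PQ(3) inP inQ by blast
    qed
    then have "is_path (E - F) B P" "is_path (E - F) B Q"
      using PQ(1,2) by (auto simp: is_path_def)
    then have "last P \<in> L" "last Q \<in> M" using PQ(4,5) by (auto simp: L_def M_def component_def)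
    then show ?thesis using PQ(6) by (auto simp: doubleton_eq_iff)
  qed
  have un: "L \<union> M = B"
  proof (rule ccontr)
    assume "L \<union> M \<noteq> B"
    then obtain z where "z \<in> B - (L \<union> M)" using LB by auto
    moreover have "conn E B" using bi by (simp add: biconn_def)
    ultimately obtain u v where uv: "u \<in> L \<union> M" "v \<in> B - (L \<union> M)" "{u, v} \<in> E"
      using connD[of E B "L \<union> M" a z] LB aL by auto
    then have "{u, v} \<in> F" using clL[of u v] clM[of u v] by blast
    then show False using crossF[of u v] uv LB by blast
  qed
  have "{x, y} \<in> F \<longleftrightarrow> (x \<in> L \<longleftrightarrow> y \<in> M)" if "x \<in> B" "y \<in> B" "{x, y} \<in> E" for x y
  proof -
    have "{x, y} \<in> F \<longleftrightarrow> x \<in> L \<and> y \<in> M \<or> x \<in> M \<and> y \<in> L"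
      using crossF[of x y] that clL[of x y] clM[of x y] dj by auto
    then show ?thesis using that un dj by blast
  qed
  then have "bond E B F L M" using un dj cL cM by (simp add: bond_def)
  then show thesis using that aL bM by blast
qed

section \<open>Tight bonds of a 3-connected graph\<close>

locale three_connected =
  fixes V :: "'a set" and E :: "'a set set"
  assumes simple: "simple_graph V E"
    and k_conn: "k_connected 3 V E"
begin

lemma edge_cases:
  assumes "e \<in> E"
  obtains x y where "x \<in> V" "y \<in> V" "x \<noteq> y" "e = {x, y}"
  using assms simple unfolding simple_graph_def by blast

lemma edge_in_V:
  assumes "{x, y} \<in> E"
  shows "x \<in> V" "y \<in> V"
proof -
  obtain u v where "u \<in> V" "v \<in> V" "{x, y} = {u, v}" using edge_cases[OF assms] by metis
  then show "x \<in> V" "y \<in> V" by (auto simp: doubleton_eq_iff)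
qed

lemma conn_delete:
  assumes "finite X" "card X < 3"
  shows "conn E (V - X)"
  unfolding conn_def
proof (intro allI impI)
  fix L assume L: "L \<subseteq> V - X" "L \<noteq> {} \<and> L \<noteq> V - X"
  \<comment> \<open>\<open>k_connected\<close> speaks only of deleted subsets of \<open>V\<close>,
    while \<open>X\<close> is arbitrary, hence \<open>X \<inter> V\<close>.\<close>
  let ?E = "{e \<in> E. e \<inter> (X \<inter> V) = {}}"
  have "finite (X \<inter> V)" "card (X \<inter> V) < 3" "X \<inter> V \<subseteq> V"
    using assms card_mono[of X "X \<inter> V"] by auto
  then have "connected_graph (V - X \<inter> V) ?E"
    using k_conn by (simp add: k_connected_def)
  then have c: "\<forall>u\<in>V - X. \<forall>v\<in>V - X. (u, v) \<in> {(x, y). {x, y} \<in> ?E}\<^sup>*"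
    by (auto simp: connected_graph_def)
  obtain a b where ab: "a \<in> L" "b \<in> V - X - L" using L by blast
  have "a \<in> V - X" "b \<in> V - X" using ab L(1) by auto
  then have "(a, b) \<in> {(x, y). {x, y} \<in> ?E}\<^sup>*" using c by blast
  then have "b \<in> L \<or> (\<exists>x\<in>L. \<exists>y\<in>V - X - L. {x, y} \<in> E)"
  proof (induction rule: rtrancl_induct)
    case base
    show ?case using ab(1) by simp
  next
    case (step y z)
    have yz: "{y, z} \<in> E" "{y, z} \<inter> (X \<inter> V) = {}" using step.hyps(2) by simp_all
    then have "z \<in> V - X" using edge_in_V(2)[of y z] by blast
    then show ?case using step.IH yz(1) by blast
  qed
  then show "\<exists>x\<in>L. \<exists>y\<in>V - X - L. {x, y} \<in> E" using ab(2) by blast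
qed

lemma biconn_V: "biconn E V"
  unfolding biconn_def using conn_delete[of "{}"] conn_delete[of "{t}" for t] by simp

text \<open>The contradictions with 3-connectivity below all take this form. \<open>s\<close> and
  \<open>t\<close> may coincide.\<close>

lemma no_two_separator:
  assumes "x \<in> L" "y \<in> V - {s, t} - L" "L \<subseteq> V - {s, t}"
    and "\<And>u v. u \<in> L \<Longrightarrow> v \<in> V - {s, t} - L \<Longrightarrow> {u, v} \<notin> E"
  shows False
proof -
  have "card {s, t} < 3" using card_insert_le_m1[of 2 "{t}" s] by (cases "s = t") auto
  then have "conn E (V - {s, t})" using conn_delete[of "{s, t}"] by simp
  then show False using connD[of E "V - {s, t}" L x y] assms by metis
qed

section \<open>The sides of a tight bond\<close>

definition nbrs :: "'a set \<Rightarrow> 'a set \<Rightarrow> 'a set" where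
  "nbrs A B = {b \<in> B. \<exists>a\<in>A. {a, b} \<in> E}"

text \<open>If the neighbourhoods in \<open>B\<close> of the two parts of \<open>A\<close> were linked by two disjoint paths,
  these could be closed up inside the two parts to a circuit with four edges in \<open>F\<close>.\<close>

lemma bond_side_separator:
  assumes tight: "tight E F" and bond: "bond E V F A B"
    and A: "A = A1 \<union> A2" "A1 \<inter> A2 = {}" and c: "conn E A1" "conn E A2"
  obtains t L where "L \<subseteq> B - {t}" "nbrs A1 B - {t} \<subseteq> L" "L \<inter> nbrs A2 B = {}"
    "\<And>x y. x \<in> L \<Longrightarrow> y \<in> B - {t} - L \<Longrightarrow> {x, y} \<notin> E"
proof -
  have AB: "A \<inter> B = {}" "A \<union> B = V" using bond by (auto simp: bond_def)
  have "nbrs A1 B \<subseteq> B" "nbrs A2 B \<subseteq> B" by (auto simp: nbrs_def)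
  then show thesis
  proof (cases rule: two_paths_or_separator[of "nbrs A1 B" B "nbrs A2 B" E])
    case (paths R R')
    have ne: "R \<noteq> []" "R' \<noteq> []" using paths by (auto simp: is_path_def)
    have RB: "set R \<subseteq> B" "set R' \<subseteq> B" using paths by (auto simp: is_path_def)
    obtain a1 a1' a2 a2' where a: "a1 \<in> A1" "{a1, hd R} \<in> E" "a1' \<in> A1" "{a1', hd R'} \<in> E"
      "a2 \<in> A2" "{a2, last R} \<in> E" "a2' \<in> A2" "{a2', last R'} \<in> E"
      using paths by (auto simp: nbrs_def)
    obtain P where P: "is_path E A1 P" "hd P = a1'" "last P = a1" using conn_path[OF c(1) a(3,1)] .
    obtain Q where Q: "is_path E A2 Q" "hd Q = a2" "last Q = a2'" using conn_path[OF c(2) a(5,7)] .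
    have PQ: "P \<noteq> []" "Q \<noteq> []" "set P \<subseteq> A1" "set Q \<subseteq> A2" using P Q by (auto simp: is_path_def)
    have p: "is_path E UNIV P" "is_path E UNIV Q" "is_path E UNIV R" "is_path E UNIV (rev R')"
      using P Q paths is_path_mono[of E _ _ E UNIV] by (auto simp: is_path_rev)
    have p1: "is_path E UNIV (P @ R)"
      by (rule is_path_append[OF p(1,3)]) (use PQ RB A AB P a in auto)
    have p2: "is_path E UNIV (Q @ rev R')"
      by (rule is_path_append[OF p(2,4)]) (use PQ RB A AB Q a ne in \<open>auto simp: hd_rev\<close>)
    define C where "C = {{last (P @ R), hd (Q @ rev R')}, {last (Q @ rev R'), hd (P @ R)}} \<union>
      path_edges (P @ R) \<union> path_edges (Q @ rev R')"
    have "length P > 0" "length Q > 0" "length R > 0" using PQ ne by simp_all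
    then have len: "3 \<le> length (P @ R) + length (Q @ rev R')" unfolding length_append by linarith
    have C: "circuit E C" unfolding C_def
      by (rule circuit_of_paths[OF p1 p2 _ _ _ len])
        (use PQ RB A AB P Q a ne paths(7) in \<open>auto simp: last_rev insert_commute\<close>)
    have inC: "{a1, hd R} \<in> C" "{a2, last R} \<in> C" "{a1', hd R'} \<in> C"
      using PQ ne P Q by (auto simp: C_def path_edges_append last_rev insert_commute)
    have inB: "hd R \<in> B" "last R \<in> B" "hd R' \<in> B" using RB ne by auto
    have inF: "{a1, hd R} \<in> F" "{a2, last R} \<in> F" "{a1', hd R'} \<in> F"
      using bond_crossing[OF bond] inB a A by auto
    have "hd R \<in> set R" "last R \<in> set R" "hd R' \<in> set R'" using ne by simp_all
    then have nR: "hd R \<noteq> hd R'" "last R \<noteq> hd R'" using paths(7) by (metis IntI empty_iff)+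
    have nB: "a1 \<notin> B" "a1' \<notin> B" "a2 \<notin> B" "a1 \<noteq> a2" "a1' \<noteq> a2" using a(1,3,5) A AB by auto
    have ne3: "{a1, hd R} \<noteq> {a2, last R}" "{a1', hd R'} \<noteq> {a1, hd R}" "{a1', hd R'} \<noteq> {a2, last R}"
      using inB nR nB by (metis doubleton_eq_iff)+
    \<comment> \<open>Three distinct edges of \<open>F\<close> on \<open>C\<close> already
      contradict tightness, so the fourth is not followed up.\<close>
    have "C \<inter> F = {{a1, hd R}, {a2, last R}}"
      by (rule tight_two[OF tight C]) (use inC inF ne3 in simp_all)
    moreover have "{a1', hd R'} \<in> C \<inter> F" using inC inF by simp
    ultimately show thesis using ne3 by simp
  next
    case (sep t L)
    then show thesis using that by blast
  qed
qed

text \<open>Suppose \<open>s\<close> is a cut vertex of \<open>A\<close>. A component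
  \<open>A1\<close> of \<open>A - {s}\<close> and the rest \<open>A2\<close>, which contains
  \<open>s\<close>, are both connected, so \<open>bond_side_separator\<close> yields a
  \<open>t\<close> that splits \<open>B\<close> accordingly. Then \<open>{s, t}\<close> separates
  \<open>A1 \<union> L\<close> from the rest of \<open>A\<close>.\<close>

lemma bond_side_biconn:
  assumes tight: "tight E F" and bond: "bond E V F A B"
  shows "biconn E A"
proof -
  have AB: "A \<inter> B = {}" "A \<union> B = V" using bond by (auto simp: bond_def)
  have cA: "conn E A" using bond_conn[OF bond] .
  have "conn E (A - {s})" for s
  proof (cases "s \<in> A")
    case True
    show ?thesis unfolding conn_def
    proof (rule ccontr)
      assume "\<not> (\<forall>L\<subseteq>A - {s}. L \<noteq> {} \<and> L \<noteq> A - {s} \<longrightarrow> (\<exists>x\<in>L. \<exists>y\<in>A - {s} - L. {x, y} \<in> E))"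
      then obtain K where K: "K \<subseteq> A - {s}" "K \<noteq> {}" "K \<noteq> A - {s}"
        "\<And>x y. x \<in> K \<Longrightarrow> y \<in> A - {s} - K \<Longrightarrow> {x, y} \<notin> E" by blast
      then obtain x y where x: "x \<in> K" and y: "y \<in> A - {s} - K" by blast
      define A1 where "A1 = component E (A - {s}) x"
      define A2 where "A2 = A - A1"
      have A1sub: "A1 \<subseteq> A - {s}" by (simp add: A1_def component_subset)
      have xA1: "x \<in> A1" using x K by (auto simp: A1_def intro: component_self)
      have cl: "v \<in> A1" if "u \<in> A1" "v \<in> A - {s}" "{u, v} \<in> E" for u v
        using component_closed[of u E "A - {s}" x v] that by (simp add: A1_def)
      have c1: "conn E A1" by (simp add: A1_def conn_component)
      have yA1: "y \<notin> A1"
      proof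
        assume "y \<in> A1"
        then obtain u v where "u \<in> A1 \<inter> K" "v \<in> A1 - A1 \<inter> K" "{u, v} \<in> E"
          using connD[OF c1, of "A1 \<inter> K" x y] x xA1 y by auto
        then show False using K(4)[of u v] A1sub by blast
      qed
      \<comment> \<open>A nonempty part of \<open>A2\<close> without \<open>s\<close> has an edge to
        the rest of \<open>A\<close>, and this edge cannot end in \<open>A1\<close>. A part
        containing \<open>s\<close> is treated through its complement.\<close>
      have c2: "conn E A2" unfolding conn_def
      proof (intro allI impI)
        fix L assume L: "L \<subseteq> A2" "L \<noteq> {} \<and> L \<noteq> A2"
        have *: "\<exists>u\<in>N. \<exists>v\<in>A2 - N. {u, v} \<in> E" if N: "N \<subseteq> A2" "N \<noteq> {}" "s \<notin> N" for N
        proof -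
          obtain z where z: "z \<in> N" using N by blast
          have NA: "N \<subseteq> A" "x \<in> A - N" using N(1) xA1 A1sub by (auto simp: A2_def)
          obtain u v where uv: "u \<in> N" "v \<in> A - N" "{u, v} \<in> E"
            using connD[OF cA NA(1) z NA(2)] .
          have "v \<notin> A1" using cl[of v u] uv N by (auto simp: A2_def insert_commute)
          then show ?thesis using uv by (auto simp: A2_def)
        qed
        show "\<exists>u\<in>L. \<exists>v\<in>A2 - L. {u, v} \<in> E"
        proof (cases "s \<in> L")
          case True
          then obtain u v where "u \<in> A2 - L" "v \<in> A2 - (A2 - L)" "{u, v} \<in> E"
            using *[of "A2 - L"] L by blast
          then have "v \<in> L" "u \<in> A2 - L" "{v, u} \<in> E" by (auto simp: insert_commute)
          then show ?thesis by blast
        qed (use * L in blast)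
      qed
      have A: "A = A1 \<union> A2" "A1 \<inter> A2 = {}" using A1sub by (auto simp: A2_def)
      obtain t' L where tL': "L \<subseteq> B - {t'}" "nbrs A1 B - {t'} \<subseteq> L" "L \<inter> nbrs A2 B = {}"
        "\<And>x y. x \<in> L \<Longrightarrow> y \<in> B - {t'} - L \<Longrightarrow> {x, y} \<notin> E"
        using bond_side_separator[OF tight bond A c1 c2] by metis
      \<comment> \<open>A \<open>t'\<close> outside \<open>B\<close> might be a vertex of
        \<open>A\<close> such as \<open>x\<close> or \<open>y\<close>, which must not be deleted;
        \<open>s\<close> is a harmless replacement.\<close>
      define t where "t = (if t' \<in> B then t' else s)"
      have Bt: "B - {t} = B - {t'}" using True AB by (auto simp: t_def)
      have t: "t \<in> B \<or> t = s" by (simp add: t_def)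
      have tL: "L \<subseteq> B - {t}" "nbrs A1 B - {t} \<subseteq> L" "L \<inter> nbrs A2 B = {}"
        "\<And>x y. x \<in> L \<Longrightarrow> y \<in> B - {t} - L \<Longrightarrow> {x, y} \<notin> E"
        using tL' Bt by (auto simp: nbrs_def)
        show False
        proof (rule no_two_separator[of x "A1 \<union> L" y s t])
          show "x \<in> A1 \<union> L" using xA1 by simp
          show "y \<in> V - {s, t} - (A1 \<union> L)" using y yA1 tL(1) AB t by auto
          show "A1 \<union> L \<subseteq> V - {s, t}" using A1sub tL(1) AB True t by auto
          fix u v assume u: "u \<in> A1 \<union> L" and v: "v \<in> V - {s, t} - (A1 \<union> L)"
          show "{u, v} \<notin> E"
          proof
            assume e: "{u, v} \<in> E"
            consider "u \<in> A1" "v \<in> A" | "u \<in> A1" "v \<in> B" | "u \<in> L" "v \<in> B" | "u \<in> L" "v \<in> A"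
              using u v AB by blast
            then show False
            proof cases
              case 1 then show False using cl e v by blast
            next
              case 2 then have "v \<in> nbrs A1 B" using e by (auto simp: nbrs_def)
              then show False using tL(2) v by blast
            next
              case 3 then show False using tL(4) e v by blast
            next
              case 4
              then have "u \<in> nbrs A2 B" using e v tL(1) by (auto simp: nbrs_def A2_def insert_commute)
              then show False using tL(3) 4 by blast
            qed
          qed
        qed
    qed
  qed (simp add: cA)
  then show ?thesis using cA by (simp add: biconn_def)
qed

text \<open>Since \<open>B\<close> has no cut vertex either, the set \<open>L\<close> of
  \<open>bond_side_separator\<close> cannot be a nonempty proper part of \<open>B - {t}\<close>. So
  one of the two neighbourhoods contains nothing besides \<open>t\<close>.\<close>

lemma bond_side_dichotomy:
  assumes tight: "tight E F" and bond: "bond E V F A B"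
    and A: "A = A1 \<union> A2" "A1 \<inter> A2 = {}" and c: "conn E A1" "conn E A2"
  shows "(\<exists>t. nbrs A1 B \<subseteq> {t}) \<or> (\<exists>t. nbrs A2 B \<subseteq> {t})"
proof -
  obtain t L where tL: "L \<subseteq> B - {t}" "nbrs A1 B - {t} \<subseteq> L" "L \<inter> nbrs A2 B = {}"
    "\<And>x y. x \<in> L \<Longrightarrow> y \<in> B - {t} - L \<Longrightarrow> {x, y} \<notin> E"
    using bond_side_separator[OF tight bond A c] by metis
  have cB: "conn E (B - {t})"
    using bond_side_biconn[OF tight bond_sym[OF bond]] by (simp add: biconn_def)
  show ?thesis
  proof (rule ccontr)
    assume "\<not> ?thesis"
    then obtain x y where "x \<in> nbrs A1 B - {t}" "y \<in> nbrs A2 B - {t}" by blast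
    then have xy: "x \<in> L" "y \<in> B - {t} - L" using tL(2,3) by (auto simp: nbrs_def)
    show False using connD[OF cB tL(1) xy] tL(4) by metis
  qed
qed

section \<open>Excluding crossing tight bonds\<close>

definition crossing :: "'a set set \<Rightarrow> 'a set \<Rightarrow> 'a set \<Rightarrow> 'a set set \<Rightarrow> 'a set \<Rightarrow> 'a set \<Rightarrow> bool" where
  "crossing F A B F' A' B' \<longleftrightarrow> tight E F \<and> tight E F' \<and> bond E V F A B \<and> bond E V F' A' B' \<and>
     A \<inter> A' \<noteq> {} \<and> A \<inter> B' \<noteq> {} \<and> B \<inter> A' \<noteq> {} \<and> B \<inter> B' \<noteq> {}"

lemma crossing_sym:
  assumes "crossing F A B F' A' B'"
  shows "crossing F' A' B' F A B" "crossing F B A F' A' B'" "crossing F A B F' B' A'"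
  using assms bond_sym[of E V F A B] bond_sym[of E V F' A' B'] by (simp_all add: crossing_def Int_commute)

lemma crossing_partition:
  assumes "crossing F A B F' A' B'"
  shows "A \<union> B = V" "A' \<union> B' = V" "A \<inter> B = {}" "A' \<inter> B' = {}"
  using assms by (auto simp: crossing_def bond_def)

text \<open>The side \<open>A\<close> is biconnected, so \<open>bond_of_tight\<close> applies to
  \<open>F'\<close> inside \<open>A\<close>. The resulting sides are connected without
  \<open>F'\<close>, hence neither changes between \<open>A'\<close> and \<open>B'\<close>; they are
  the two quadrants in \<open>A\<close>.\<close>

lemma crossing_quadrants:
  assumes cr: "crossing F A B F' A' B'"
  shows "\<exists>x\<in>A \<inter> A'. \<exists>y\<in>A \<inter> B'. {x, y} \<in> E" "conn E (A \<inter> A')"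
proof -
  note part = crossing_partition[OF cr]
  have t: "tight E F" "tight E F'" and b: "bond E V F A B" "bond E V F' A' B'"
    using cr by (simp_all add: crossing_def)
  have bi: "biconn E A" using bond_side_biconn[OF t(1) b(1)] .
  obtain x0 y0 where x0: "x0 \<in> A \<inter> A'" "y0 \<in> A \<inter> B'" using cr by (auto simp: crossing_def)
  have "y0 \<in> A - A \<inter> A'" using x0 part by blast
  then obtain x y where "x \<in> A \<inter> A'" "y \<in> A - A \<inter> A'" and xyE: "{x, y} \<in> E"
    using connD[of E A "A \<inter> A'" x0 y0] bi x0(1) by (metis biconn_def inf_le1)
  then have xy: "x \<in> A \<inter> A'" "y \<in> A \<inter> B'" using part by auto
  then show "\<exists>x\<in>A \<inter> A'. \<exists>y\<in>A \<inter> B'. {x, y} \<in> E" using xyE by blast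
  have "{x, y} \<in> F'" using bond_crossing[OF b(2)] xy xyE by simp
  then obtain L M where LM: "bond E A F' L M" "x \<in> L" "y \<in> M"
    using bond_of_tight[OF simple bi t(2), of x y] xy by blast
  have sub: "L \<subseteq> A" "M \<subseteq> A" "L \<union> M = A" using LM(1) by (auto simp: bond_def)
  have one_side: "K \<subseteq> P" if K: "conn (E - F') K" "K \<subseteq> A" "k \<in> K" "k \<in> P" "bond E V F' P Q" for K P Q k
  proof (rule ccontr)
    assume "\<not> K \<subseteq> P"
    then obtain z where "z \<in> K - K \<inter> P" by blast
    then obtain u v where uv: "u \<in> K \<inter> P" "v \<in> K - K \<inter> P" "{u, v} \<in> E - F'"
      using connD[OF K(1), of "K \<inter> P" k z] K(3,4) by blast
    then have "v \<in> Q" using K(2,5) part(1) by (auto simp: bond_def)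
    then show False using bond_crossing[OF K(5), of u v] uv by blast
  qed
  have "L \<subseteq> A'" using one_side[of L x A' B'] LM sub b(2) xy by (simp add: bond_def)
  moreover have "M \<subseteq> B'" using one_side[of M y B' A'] LM(1,3) sub bond_sym[OF b(2)] xy by (simp add: bond_def)
  ultimately have "L = A \<inter> A'" using sub part(4) by blast
  then show "conn E (A \<inter> A')" using bond_conn[OF LM(1)] by simp
qed

lemma nbrs_single:
  assumes "\<exists>t. nbrs A B \<subseteq> {t}" "a \<in> A" "b \<in> B" "{a, b} \<in> E"
  shows "nbrs A B = {b}"
proof -
  have "b \<in> nbrs A B" using assms(2-4) by (auto simp: nbrs_def)
  then show ?thesis using assms(1) by blast
qed

text \<open>\<open>B\<close> and \<open>B'\<close> together cover everything outside the quadrant,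
  which would thus have only two outer neighbours. By \<open>crossing_quadrants\<close> these lie in
  the two adjacent quadrants, so the opposite quadrant is cut off.\<close>

lemma crossing_not_both:
  assumes cr: "crossing F A B F' A' B'"
  shows "\<not> ((\<exists>t. nbrs (A \<inter> A') B \<subseteq> {t}) \<and> (\<exists>t. nbrs (A \<inter> A') B' \<subseteq> {t}))"
proof
  assume s: "(\<exists>t. nbrs (A \<inter> A') B \<subseteq> {t}) \<and> (\<exists>t. nbrs (A \<inter> A') B' \<subseteq> {t})"
  note part = crossing_partition[OF cr]
  obtain x y where xy: "x \<in> A \<inter> A'" "y \<in> A \<inter> B'" "{x, y} \<in> E"
    using crossing_quadrants(1)[OF cr] by blast
  obtain x' z where xz: "x' \<in> A \<inter> A'" "z \<in> B \<inter> A'" "{x', z} \<in> E"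
    using crossing_quadrants(1)[OF crossing_sym(1)[OF cr]] by blast
  obtain w where w: "w \<in> B \<inter> B'" using cr by (auto simp: crossing_def)
  have ny: "nbrs (A \<inter> A') B' = {y}" and nz: "nbrs (A \<inter> A') B = {z}"
    using nbrs_single[of "A \<inter> A'"] s xy xz by blast+
  show False
  proof (rule no_two_separator[of x "A \<inter> A'" w z y])
    show "x \<in> A \<inter> A'" by (fact xy)
    show "w \<in> V - {z, y} - A \<inter> A'" using w xy xz part by blast
    show "A \<inter> A' \<subseteq> V - {z, y}" using xy xz part by blast
    show "{u, v} \<notin> E" if "u \<in> A \<inter> A'" "v \<in> V - {z, y} - A \<inter> A'" for u v
    proof
      assume "{u, v} \<in> E"
      then have "v \<in> nbrs (A \<inter> A') B \<or> v \<in> nbrs (A \<inter> A') B'"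
        using that part by (auto simp: nbrs_def)
      then show False using ny nz that by blast
    qed
  qed
qed

text \<open>The three conditions leave so few edges that any further vertex of
  \<open>A \<inter> A'\<close> or \<open>A \<inter> B'\<close> could be cut off by two vertices.
  Hence \<open>A\<close> is \<open>{x, y}\<close>, and \<open>x\<close> has no neighbours besides
  \<open>y\<close> and \<open>z\<close>.\<close>

lemma crossing_not_ring:
  assumes cr: "crossing F A B F' A' B'"
  shows "\<not> ((\<exists>t. nbrs (A \<inter> A') B \<subseteq> {t}) \<and> (\<exists>t. nbrs (A \<inter> B') A' \<subseteq> {t}) \<and> (\<exists>t. nbrs (B \<inter> B') A \<subseteq> {t}))"
proof
  assume s: "(\<exists>t. nbrs (A \<inter> A') B \<subseteq> {t}) \<and> (\<exists>t. nbrs (A \<inter> B') A' \<subseteq> {t}) \<and> (\<exists>t. nbrs (B \<inter> B') A \<subseteq> {t})"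
  note part = crossing_partition[OF cr]
  obtain x y0 where xy: "x \<in> A \<inter> A'" "y0 \<in> A \<inter> B'" "{x, y0} \<in> E"
    using crossing_quadrants(1)[OF cr] by blast
  obtain x0 z where xz: "x0 \<in> A \<inter> A'" "z \<in> B \<inter> A'" "{x0, z} \<in> E"
    using crossing_quadrants(1)[OF crossing_sym(1)[OF cr]] by blast
  obtain y w where yw: "y \<in> A \<inter> B'" "w \<in> B \<inter> B'" "{y, w} \<in> E"
    using crossing_quadrants(1)[OF crossing_sym(1)[OF crossing_sym(3)[OF cr]]] by blast
  have nX: "nbrs (A \<inter> A') B = {z}" using nbrs_single[of "A \<inter> A'"] s xz by blast
  have nY: "nbrs (A \<inter> B') A' = {x}" using nbrs_single[of "A \<inter> B'" _ y0 x] s xy by (auto simp: insert_commute)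
  have nW: "nbrs (B \<inter> B') A = {y}" using nbrs_single[of "B \<inter> B'" _ w y] s yw by (auto simp: insert_commute)
  have nX': "v = z" if "u \<in> A \<inter> A'" "v \<in> B" "{u, v} \<in> E" for u v
    using that nX by (auto simp: nbrs_def)
  have nY': "v = x" if "u \<in> A \<inter> B'" "v \<in> A'" "{u, v} \<in> E" for u v
    using that nY by (auto simp: nbrs_def)
  have nW': "v = y" if "u \<in> B \<inter> B'" "v \<in> A" "{u, v} \<in> E" for u v
    using that nW by (auto simp: nbrs_def)
  have X: "A \<inter> A' = {x}"
  proof (rule ccontr)
    assume "A \<inter> A' \<noteq> {x}"
    then obtain k where k: "k \<in> A \<inter> A' - {x}" using xy by blast
    show False
    \<comment> \<open>Edges into \<open>B\<close> end at \<open>z\<close>, and only \<open>x\<close>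
      has edges to \<open>A \<inter> B'\<close>, by the condition on that quadrant.\<close>
    proof (rule no_two_separator[of k "A \<inter> A' - {x}" y x z])
      show "y \<in> V - {x, z} - (A \<inter> A' - {x})" using xy xz yw part by blast
      show "A \<inter> A' - {x} \<subseteq> V - {x, z}" using xz part by blast
      fix u v assume u: "u \<in> A \<inter> A' - {x}" and v: "v \<in> V - {x, z} - (A \<inter> A' - {x})"
      show "{u, v} \<notin> E"
      proof
        assume e: "{u, v} \<in> E"
        consider "v \<in> B" | "v \<in> A \<inter> B'" using v part by blast
        then show False
          using nX'[of u v] nY'[of v u] e u v by (cases; force simp: insert_commute)
      qed
    qed (fact k)
  qed
  have Y: "A \<inter> B' = {y}"
  proof (rule ccontr)
    assume "A \<inter> B' \<noteq> {y}"
    then obtain k where k: "k \<in> A \<inter> B' - {y}" using yw by blast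
    show False
    proof (rule no_two_separator[of k "A \<inter> B' - {y}" w y x])
      show "w \<in> V - {y, x} - (A \<inter> B' - {y})" using xy yw part by blast
      show "A \<inter> B' - {y} \<subseteq> V - {y, x}" using xy part by blast
      fix u v assume u: "u \<in> A \<inter> B' - {y}" and v: "v \<in> V - {y, x} - (A \<inter> B' - {y})"
      show "{u, v} \<notin> E"
      proof
        assume e: "{u, v} \<in> E"
        consider "v \<in> A'" | "v \<in> B \<inter> B'" using v part by blast
        then show False
          using nY'[of u v] nW'[of v u] e u v by (cases; force simp: insert_commute)
      qed
    qed (fact k)
  qed
  show False
  proof (rule no_two_separator[of x "{x}" w y z])
    show "w \<in> V - {y, z} - {x}" using xy xz yw part by blast
    show "{x} \<subseteq> V - {y, z}" using xy xz yw part by blast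
    fix u v assume u: "u \<in> {x}" and v: "v \<in> V - {y, z} - {x}"
    have "v \<in> B" using v X Y part by blast
    then show "{u, v} \<notin> E" using nX'[of u v] u v xy(1) by blast
  qed simp
qed

text \<open>For each pair of adjacent quadrants one has at most one neighbour across the other bond. No
  quadrant is of this kind for both bonds, so the two kinds alternate around the ring
  \<open>A \<inter> A'\<close>, \<open>A \<inter> B'\<close>, \<open>B \<inter> B'\<close>, \<open>B \<inter> A'\<close>. Both alternating patterns are excluded by
  \<open>crossing_not_ring\<close>, up to exchanging \<open>A'\<close> and \<open>B'\<close>.\<close>

lemma not_crossing: "\<not> crossing F A B F' A' B'"
proof
  assume cr: "crossing F A B F' A' B'"
  have dich: "(\<exists>t. nbrs (P \<inter> P') Q \<subseteq> {t}) \<or> (\<exists>t. nbrs (P \<inter> Q') Q \<subseteq> {t})"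
    if c: "crossing G P Q G' P' Q'" for G P Q G' P' Q'
  proof (rule bond_side_dichotomy)
    show "tight E G" "bond E V G P Q" using c by (simp_all add: crossing_def)
    show "P = P \<inter> P' \<union> P \<inter> Q'" "P \<inter> P' \<inter> (P \<inter> Q') = {}" using crossing_partition[OF c] by blast+
    show "conn E (P \<inter> P')" "conn E (P \<inter> Q')"
      using crossing_quadrants(2)[OF c] crossing_quadrants(2)[OF crossing_sym(3)[OF c]] by simp_all
  qed
  note sA = crossing_sym(2)[OF cr] and sA' = crossing_sym(3)[OF cr]
  note sAA = crossing_sym(3)[OF sA]
  have d: "(\<exists>t. nbrs (A \<inter> A') B \<subseteq> {t}) \<or> (\<exists>t. nbrs (A \<inter> B') B \<subseteq> {t})"
    "(\<exists>t. nbrs (B \<inter> A') A \<subseteq> {t}) \<or> (\<exists>t. nbrs (B \<inter> B') A \<subseteq> {t})"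
    "(\<exists>t. nbrs (A \<inter> A') B' \<subseteq> {t}) \<or> (\<exists>t. nbrs (B \<inter> A') B' \<subseteq> {t})"
    "(\<exists>t. nbrs (A \<inter> B') A' \<subseteq> {t}) \<or> (\<exists>t. nbrs (B \<inter> B') A' \<subseteq> {t})"
    using dich[OF cr] dich[OF sA] dich[OF crossing_sym(1)[OF cr]] dich[OF crossing_sym(1)[OF sA']]
    by (simp_all only: Int_commute)
  note n = crossing_not_both[OF cr] crossing_not_both[OF sA] crossing_not_both[OF sA'] crossing_not_both[OF sAA]
  show False using d n crossing_not_ring[OF cr] crossing_not_ring[OF sA'] by argo
qed

end

section \<open>Pulling back the stars of the image graph\<close>

text \<open>This makes the final vertex map injective, and surjective because every vertex lies on
  an edge.\<close>

lemma (in three_connected) two_edges_at: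
  assumes "u \<in> V"
  obtains x y where "x \<noteq> y" "{u, x} \<in> E" "{u, y} \<in> E"
proof -
  have more: "\<exists>c\<in>V. c \<noteq> a \<and> c \<noteq> b" for a b
  proof (rule ccontr)
    assume "\<not> ?thesis"
    then have sub: "V \<subseteq> {a, b}" by auto
    have "card V \<le> card {a, b}" by (rule card_mono) (use sub in auto)
    also have "\<dots> \<le> 2" by (cases "a = b") auto
    finally show False using k_conn finite_subset[OF sub] by (simp add: k_connected_def)
  qed
  have nb: "\<exists>x. x \<noteq> t \<and> {u, x} \<in> E" if "t \<noteq> u" for t
  proof -
    have c: "conn E (V - {t})" using biconn_V by (simp add: biconn_def)
    obtain z where z: "z \<in> V" "z \<noteq> u" "z \<noteq> t" using more by blast
    show ?thesis using connD[OF c, of "{u}" u z] assms that z by auto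
  qed
  obtain z where "z \<in> V" "z \<noteq> u" using more by blast
  then obtain x where x: "{u, x} \<in> E" using nb by blast
  have "x \<noteq> u" using loop_free[OF simple x] by simp
  then obtain y where "y \<noteq> x" "{u, y} \<in> E" using nb by blast
  then show thesis using that x by blast
qed

locale circuit_injection = three_connected V E
  for V :: "'a set" and E :: "'a set set" +
  fixes V' :: "'b set" and E' :: "'b set set" and f :: "'a set \<Rightarrow> 'b set"
  assumes simple': "simple_graph V' E'"
    and inj_onto: "circuit_injection_onto E V' E' f"
begin

definition pullback :: "'b \<Rightarrow> 'a set set" where
  "pullback v = {e \<in> E. v \<in> f e}"

lemma bij: "bij_betw f E E'" and circuit_image: "circuit E C \<Longrightarrow> circuit E' (f ` C)"
  and V'_eq: "V' = \<Union>E'"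
  using inj_onto by (simp_all add: circuit_injection_onto_def)

lemma inj: "inj_on f E"
  using bij by (rule bij_betw_imp_inj_on)

text \<open>By injectivity, the edges of \<open>C\<close> in the pullback are as many as the edges
  at \<open>v\<close> in the image circuit.\<close>

lemma tight_pullback: "tight E (pullback v)"
  unfolding tight_def
proof (intro conjI allI impI)
  show "pullback v \<subseteq> E" by (auto simp: pullback_def)
  fix C assume C: "circuit E C"
  then have CE: "C \<subseteq> E" by (simp add: circuit_def)
  have eq: "f ` (C \<inter> pullback v) = {e \<in> f ` C. v \<in> e}" using CE by (auto simp: pullback_def)
  have "card (f ` (C \<inter> pullback v)) = card (C \<inter> pullback v)"
    by (rule card_image) (use inj CE in \<open>auto intro: inj_on_subset\<close>)
  then show "card (C \<inter> pullback v) = 0 \<or> card (C \<inter> pullback v) = 2"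
    using circuit_degree[OF circuit_image[OF C], of v] eq by simp
qed

lemma bond_pullback:
  assumes "v \<in> V'"
  obtains A B a b where "bond E V (pullback v) A B" "a \<in> A" "b \<in> B" "{a, b} \<in> pullback v"
proof -
  obtain e' where "e' \<in> E'" "v \<in> e'" using assms V'_eq by blast
  moreover have "E' = f ` E" using bij by (simp add: bij_betw_def)
  ultimately obtain e where e: "e \<in> E" "v \<in> f e" by blast
  then obtain a b where ab: "a \<in> V" "b \<in> V" "e = {a, b}" using edge_cases by metis
  then have "{a, b} \<in> pullback v" using e by (simp add: pullback_def)
  then show thesis using bond_of_tight[OF simple biconn_V tight_pullback ab(1,2)] that by metis
qed

lemma conn_edge:
  assumes "conn E A" "\<nexists>u. A = {u}" "a \<in> A"
  obtains p q where "p \<in> A" "q \<in> A" "{p, q} \<in> E"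
proof -
  obtain z where "z \<in> A - {a}" using assms(2,3) by blast
  then show thesis using connD[OF assms(1), of "{a}" a z] assms(3) that by blast
qed

lemma bond_pullback_singleton:
  assumes bond: "bond E V (pullback v) A B" and ab: "a \<in> A" "b \<in> B"
  shows "(\<exists>u. A = {u}) \<or> (\<exists>u. B = {u})"
proof (rule ccontr)
  let ?F = "pullback v"
  assume non: "\<not> ?thesis"
  have AB: "A \<union> B = V" "A \<inter> B = {}" using bond by (auto simp: bond_def)
  obtain p q where pq: "p \<in> A" "q \<in> A" "{p, q} \<in> E"
    using conn_edge[OF bond_conn[OF bond]] non ab by metis
  obtain r s where rs: "r \<in> B" "s \<in> B" "{r, s} \<in> E"
    using conn_edge[OF bond_conn[OF bond_sym[OF bond]]] non ab by metis
  have inV: "p \<in> V" "q \<in> V" "r \<in> V" "s \<in> V" using pq rs AB by auto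
  have "{p, q} \<noteq> {r, s}" using pq rs AB by (auto simp: doubleton_eq_iff)
  then obtain P Q where P: "is_path E V P" "hd P = p" and Q: "{last P, last Q} = {r, s}"
    and C: "circuit E ({{p, q}, {r, s}} \<union> path_edges P \<union> path_edges Q)"
    using circuit_through_two_edges[OF simple biconn_V inV(1,2) pq(3) inV(3,4) rs(3)] by metis
  define D where "D = {{p, q}, {r, s}} \<union> path_edges P \<union> path_edges Q"
  have D: "circuit E D" "{p, q} \<in> D" "{r, s} \<in> D" "path_edges P \<subseteq> D" "D \<subseteq> E"
    using C by (auto simp: D_def circuit_def)
  \<comment> \<open>The circuit \<open>D\<close> has to pass from \<open>A\<close> to
    \<open>B\<close>, so it contains an edge of \<open>?F\<close>. This puts \<open>v\<close> on the
    image circuit, and removing \<open>v\<close> does leave a path.\<close>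
  have "last P \<notin> A" using Q rs AB by (auto simp: doubleton_eq_iff)
  moreover have "P \<noteq> []" using P by (simp add: is_path_def)
  ultimately obtain x y where xy: "x \<in> A" "y \<notin> A" "y \<in> set P" "{x, y} \<in> path_edges P"
    using path_crossing[of P A] P pq by metis
  then have "y \<in> B" using P AB by (auto simp: is_path_def)
  then have "{x, y} \<in> ?F" using bond_crossing[OF bond] xy D by blast
  then have "v \<in> \<Union>(f ` D)" using xy D by (auto simp: pullback_def)
  then obtain ys where ys: "v \<notin> set ys" "f ` D = {{v, hd ys}, {v, last ys}} \<union> path_edges ys"
    using circuit_at_vertex[OF circuit_image[OF D(1)]] by metis
  \<comment> \<open>Edges whose image avoids \<open>v\<close> do not cross the bond, so every edge
    of the path \<open>ys\<close> comes from inside one side.\<close>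
  have side: "e \<subseteq> A \<or> e \<subseteq> B" if e: "e \<in> E" "v \<notin> f e" for e
  proof -
    obtain c d where cd: "c \<in> V" "d \<in> V" "e = {c, d}" using edge_cases[OF e(1)] by metis
    have "{c, d} \<notin> ?F" using e cd by (simp add: pullback_def)
    then have "\<not> (c \<in> A \<and> d \<in> B)" "\<not> (c \<in> B \<and> d \<in> A)"
      using bond_crossing[OF bond, of c d] bond_crossing[OF bond_sym[OF bond], of c d] cd e(1) by blast+
    then show ?thesis using cd AB by blast
  qed
  have on_path: "f e \<in> path_edges ys" if "e \<in> D" "e \<notin> ?F" for e
  proof -
    have "v \<notin> f e" using that D(5) by (auto simp: pullback_def)
    then show ?thesis using that(1) ys(2) by blast
  qed
  let ?K = "\<lambda>S. f ` {e \<in> D. e \<subseteq> S}"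
  have "path_edges ys \<subseteq> ?K A \<union> ?K B"
  proof
    fix e' assume e': "e' \<in> path_edges ys"
    then obtain e where e: "e \<in> D" "e' = f e" using ys(2) by blast
    moreover have "v \<notin> e'" using path_edges_subset[OF e'] ys(1) by blast
    ultimately show "e' \<in> ?K A \<union> ?K B" using side[of e] D(5) by blast
  qed
  moreover have "f {p, q} \<in> path_edges ys \<inter> ?K A"
    using on_path[of "{p, q}"] bond_inside[OF bond pq] D(2) pq by blast
  moreover have "f {r, s} \<in> path_edges ys \<inter> ?K B"
    using on_path[of "{r, s}"] bond_inside[OF bond_sym[OF bond] rs] D(3) rs by blast
  ultimately obtain w e1' e2' where w: "w \<in> set ys" "e1' \<in> ?K A" "e2' \<in> ?K B" "w \<in> e1'" "w \<in> e2'"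
    using path_colour_change[of ys "?K A" "?K B"] by blast
  then obtain e1 e2 where e: "e1 \<in> D" "e1 \<subseteq> A" "w \<in> f e1" "e2 \<in> D" "e2 \<subseteq> B" "w \<in> f e2" by blast
  have "f e1 \<in> E'" using e D(5) bij by (auto simp: bij_betw_def)
  then have "w \<in> V'" using e V'_eq by blast
  then obtain A' B' where bw: "bond E V (pullback w) A' B'" using bond_pullback by metis
  \<comment> \<open>An edge of the bond of \<open>w\<close> has an end on each of its sides, so a
    set containing this edge meets both.\<close>
  have meets: "S \<inter> A' \<noteq> {} \<and> S \<inter> B' \<noteq> {}" if "e \<in> D" "e \<subseteq> S" "w \<in> f e" for e S
  proof -
    have eE: "e \<in> E" using that D(5) by blast
    then obtain c d where cd: "c \<in> V" "d \<in> V" "e = {c, d}" using edge_cases by metis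
    have "{c, d} \<in> pullback w" using that eE cd by (simp add: pullback_def)
    then have "\<not> (c \<in> A' \<and> d \<in> A')" "\<not> (c \<in> B' \<and> d \<in> B')"
      using bond_inside[OF bw, of c d] bond_inside[OF bond_sym[OF bw], of c d] cd eE by blast+
    moreover have "A' \<union> B' = V" using bw by (simp add: bond_def)
    ultimately show ?thesis using cd that(2) by blast
  qed
  have "crossing ?F A B (pullback w) A' B'"
    using tight_pullback bond bw meets[OF e(1-3)] meets[OF e(4-6)] by (simp add: crossing_def)
  then show False using not_crossing by blast
qed

section \<open>From stars to the vertex bijection\<close>

lemma pullback_star:
  assumes "v \<in> V'"
  shows "\<exists>u\<in>V. pullback v = {e \<in> E. u \<in> e}"
proof -
  obtain A B a b where bd: "bond E V (pullback v) A B" and ab: "a \<in> A" "b \<in> B"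
    using bond_pullback[OF assms] by metis
  have star: "pullback v = {e \<in> E. u \<in> e}" if b: "bond E V (pullback v) {u} M" for u M
  proof -
    have "e \<in> pullback v \<longleftrightarrow> u \<in> e" if e: "e \<in> E" for e
    proof -
      obtain c d where cd: "c \<in> V" "d \<in> V" "c \<noteq> d" "e = {c, d}" using edge_cases[OF e] by metis
      have "{c, d} \<in> pullback v \<longleftrightarrow> (c = u \<longleftrightarrow> d \<in> M)" "M = V - {u}"
        using b cd e by (auto simp: bond_def)
      then show ?thesis using cd by auto
    qed
    then show ?thesis by (auto simp: pullback_def)
  qed
  have "A \<subseteq> V" "B \<subseteq> V" using bd by (auto simp: bond_def)
  then show ?thesis
    using bond_pullback_singleton[OF bd ab] star bd bond_sym[OF bd] by (metis insert_subset)
qed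

lemma induced_by_vertex_bijection:
  "\<exists>l. bij_betw l V V' \<and> (\<forall>u v. {u, v} \<in> E \<longrightarrow> f {u, v} = {l u, l v})"
proof -
  \<comment> \<open>Stars pull back, so the natural map \<open>m\<close> goes from \<open>V'\<close>
    to \<open>V\<close>; the required bijection is its inverse.\<close>
  have "\<forall>v\<in>V'. \<exists>u. u \<in> V \<and> pullback v = {e \<in> E. u \<in> e}" using pullback_star by blast
  then obtain m where m: "\<forall>v\<in>V'. m v \<in> V \<and> pullback v = {e \<in> E. m v \<in> e}"
    by (rule bchoice[THEN exE])
  have inc: "v \<in> f e \<longleftrightarrow> m v \<in> e" if v: "v \<in> V'" and e: "e \<in> E" for v e
  proof -
    have "e \<in> pullback v \<longleftrightarrow> m v \<in> e" using m v e by simp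
    then show ?thesis using e by (simp add: pullback_def)
  qed
  have image: "\<exists>v\<in>V'. \<exists>w\<in>V'. v \<noteq> w \<and> f e = {v, w}" if "e \<in> E" for e
  proof -
    have "f e \<in> E'" using bij that by (auto simp: bij_betw_def)
    then obtain v w where "v \<in> V'" "w \<in> V'" "v \<noteq> w" "f e = {v, w}"
      using simple' unfolding simple_graph_def by metis
    then show ?thesis by blast
  qed
  have inj_m: "inj_on m V'"
  proof (rule inj_onI, rule ccontr)
    fix v w assume vw: "v \<in> V'" "w \<in> V'" "m v = m w" "v \<noteq> w"
    obtain x y where xy: "x \<noteq> y" "{m v, x} \<in> E" "{m v, y} \<in> E"
      using two_edges_at m vw(1) by metis
    \<comment> \<open>All edges at the common value of \<open>m\<close> would have the image
      \<open>{v, w}\<close>, but there are two such edges and \<open>f\<close> is injective.\<close>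
    have "f e = {v, w}" if "e \<in> E" "m v \<in> e" for e
      using image[OF that(1)] inc[of v e] inc[of w e] that vw by auto
    then have "f {m v, x} = f {m v, y}" using xy by simp
    then have "{m v, x} = {m v, y}" using inj xy by (auto dest: inj_onD)
    then show False using xy(1) by (auto simp: doubleton_eq_iff)
  qed
  have edge: "\<exists>v\<in>V'. \<exists>w\<in>V'. f e = {v, w} \<and> e = {m v, m w}" if e: "e \<in> E" for e
  proof -
    obtain v w where vw: "v \<in> V'" "w \<in> V'" "v \<noteq> w" "f e = {v, w}" using image[OF e] by blast
    have "m v \<noteq> m w" using inj_m vw by (auto dest: inj_onD)
    moreover have "m v \<in> e" "m w \<in> e" using inc[of _ e] vw e by auto
    moreover obtain c d where "e = {c, d}" using edge_cases[OF e] by metis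
    ultimately have "e = {m v, m w}" by auto
    then show ?thesis using vw by blast
  qed
  have "m ` V' = V"
  proof
    show "m ` V' \<subseteq> V" using m by blast
    show "V \<subseteq> m ` V'"
    proof
      fix u assume "u \<in> V"
      then obtain x where "{u, x} \<in> E" using two_edges_at by metis
      then obtain v w where "v \<in> V'" "w \<in> V'" "{u, x} = {m v, m w}" using edge by metis
      then show "u \<in> m ` V'" by (auto simp: doubleton_eq_iff)
    qed
  qed
  then have bm: "bij_betw m V' V" using inj_m by (simp add: bij_betw_def)
  let ?l = "inv_into V' m"
  have "f {u, v} = {?l u, ?l v}" if "{u, v} \<in> E" for u v
  proof -
    obtain a b where ab: "a \<in> V'" "b \<in> V'" "f {u, v} = {a, b}" "{u, v} = {m a, m b}"
      using edge[OF \<open>{u, v} \<in> E\<close>] by blast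
    have "{?l u, ?l v} = ?l ` {m a, m b}" using ab(4) by (metis image_empty image_insert)
    then show ?thesis using ab inj_m by simp
  qed
  then show ?thesis using bij_betw_inv_into[OF bm] by blast
qed

end

theorem theorem6:
  fixes V :: "'a set" and E :: "'a set set"
    and V' :: "'b set" and E' :: "'b set set"
    and f :: "'a set \<Rightarrow> 'b set"
  assumes "simple_graph V E"
    and "k_connected 3 V E"
    and "simple_graph V' E'"
    and "circuit_injection_onto E V' E' f"
  shows "\<exists>l. bij_betw l V V' \<and> (\<forall>u v. {u, v} \<in> E \<longrightarrow> f {u, v} = {l u, l v})"
proof -
  interpret circuit_injection V E V' E' f
    using assms by unfold_locales
  show ?thesis by (rule induced_by_vertex_bijection)
qed

end
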